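(* Let $(X,\delta,m)$ be a cell complex and let $\omega:X\to(0,\infty)$ be non-degenerate. Let $k\in\mathbb{N}=\{1,2,\dots\}$ and $R\in\mathbb{R}$. The following statements are equivalent: (i) $F_\omega(x)\ge R$ for all $x\in X_k$; (ii) $\|e^{-tH}f\|_{\omega,\infty}\le e^{-Rt}\|f\|_{\omega,\infty}$ for all $f\in C(X_k)$ and all $t\ge0$; (iii) $\|e^{-tH}f\|_{\omega,p}\le e^{-Rt}\|f\|_{\omega,p}$ for all $f\in C(X_k)$, all $p\in[1,\infty]$ and all $t\ge0$; (iv) $H_k-R$ is diagonally dominant with respect to $\omega$, where $H_k=H|_{C(X_k)}$.
   Context: For a finite set $X$, $C(X)=\mathbb{R}^X$, and $x\in X$ is identified with its indicator function $1_x\in C(X)$. A cell complex $K=(X,\delta,m)$ consists of a finite set of cells $X=\dot\bigcup_{k\ge 0}X_k$, a linear operator $\delta:C(X)\to C(X)$ (coboundary) and a weight $m:X\to(0,\infty)$. Write $\dim(z)=k$ iff $z\in X_k$, and $x\lessdot z$ (equivalently $z\gtrdot x$) iff $\delta x(z)\ne 0$. It is required that for all $v,z,z'\in X$: $\delta v(z)\in\{-1,0,1\}$; $\delta v(z)=0$ if $\dim(z)-\dim(v)\ne 1$; if $\dim(z)\ge 1$ there exists $x\lessdot z$; and (i) for every $x\in X_1$ there is exactly one $w\in X_0$ with $\delta w(x)=1$ and exactly one $w\in X_0$ with $\delta w(x)=-1$; (ii) if $\dim(z)-\dim(v)=2$ and $\{x:v\lessdot x\lessdot z\}\ne\emptyset$,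 then $|\{x:v\lessdot x\lessdot z\}|=2$ and $\{\delta v(x)\,\delta x(z):x\in X\}\supseteq\{-1,1\}$ (hence $\delta\delta=0$); (iii) if $\dim(z)\ge 2$ and $x,y\lessdot z$, there is a sequence $x=x_0,\dots,x_n=y$ of cells in $\{u:u\lessdot z\}\cup\{v: v\lessdot u\lessdot z\text{ for some }u\}$ with $\delta x_i(x_{i-1})+\delta x_{i-1}(x_i)\ne0$ for $i=1,\dots,n$; (iv) if $\{x:x\lessdot z\}=\{x:x\lessdot z'\}$ and $\dim(z)\ge 1$, then $z=z'$. $C(X)$ carries the scalar product $\langle f,g\rangle=\sum_{x\in X}f(x)g(x)m(x)$, $\delta^*$ is the adjoint of $\delta$, and $H=\delta\delta^*+\delta^*\delta$ is the Hodge Laplacian; $H$ maps $C(X_k)$ to $C(X_k)$. For $v,w\in X_0$, $v\sim w$ iff they are the two vertices of some edge $x\in X_1$, in which case $\omega(v,w)=\omega(x)$. $d_\omega(v,w)=\inf\{\sum_{k=1}^n\omega(v_k,v_{k-1}):v=v_0\sim\dots\sim v_n=w\}$. $\omega$ is non-degenerate if every edge $x=(v,w)\in X_1$ is the unique shortest path (with respect to $d_\omega$) between its vertices. $F_\omega(x)=Hx(x)-\sum_{y\ne x}\frac{\omega(y)}{\omega(x)}|Hy(x)|$. Norms: $\|f\|_{\omega,\infty}=\max_x|f(x)/\omega(x)|$ and $\|f\|_{\omega,p}=\|\omega^{\frac2p-1}f\|_p$ for $p\in[1,\infty)$, where $\|g\|_p^p=\sum_x m(x)|g(x)|^p$. A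 selfadjoint operator $A$ on $C(Y)$ (with respect to the scalar product weighted by $m$; $Y$ finite) is diagonally dominant with respect to $\omega$ (and non-negative) if $\omega(x)Ax(x)\ge\sum_{y\ne x}\omega(y)|Ay(x)|$ for all $x\in Y$. *)

theory Defs
  imports "HOL-Analysis.Analysis"
begin

section \<open>Functions and operators on a finite set\<close>

text \<open>The finite set \<open>X\<close> is the type \<open>'a :: finite\<close> and \<open>C(X)\<close> is \<open>real ^ 'a\<close>. A cell \<open>x\<close>, regarded as
  an element of \<open>C(X)\<close>, is its indicator function \<open>cell x\<close>; so \<open>T x (z)\<close> is written
  \<open>T (cell x) $ z\<close>.\<close>

abbreviation cell :: "'a::finite \<Rightarrow> real ^ 'a" where
  "cell x \<equiv> axis x 1"

text \<open>For \<open>Y \<subseteq> X\<close>, \<open>C(Y)\<close> is the subspace of \<open>C(X)\<close> of functions vanishing off \<open>Y\<close>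
  (extension by zero).\<close>

definition fun_space :: "'a::finite set \<Rightarrow> (real ^ 'a) set" where
  "fun_space Y = {f. \<forall>x. x \<notin> Y \<longrightarrow> f $ x = 0}"

definition scalar_prod :: "('a::finite \<Rightarrow> real) \<Rightarrow> real ^ 'a \<Rightarrow> real ^ 'a \<Rightarrow> real" where
  "scalar_prod m f g = (\<Sum>x\<in>UNIV. f $ x * g $ x * m x)"

text \<open>The library's \<^const>\<open>adjoint\<close>, but for the scalar product weighted by \<open>m\<close>.\<close>

definition wadjoint ::
  "('a::finite \<Rightarrow> real) \<Rightarrow> (real ^ 'a \<Rightarrow> real ^ 'a) \<Rightarrow> real ^ 'a \<Rightarrow> real ^ 'a" where
  "wadjoint m T = (SOME T'. \<forall>f g. scalar_prod m (T f) g = scalar_prod m f (T' g))"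

definition op_exp :: "('b::real_normed_vector \<Rightarrow> 'b) \<Rightarrow> 'b \<Rightarrow> 'b" where
  "op_exp T f = (\<Sum>n. (T ^^ n) f /\<^sub>R fact n)"

definition hodge ::
  "('a::finite \<Rightarrow> real) \<Rightarrow> (real ^ 'a \<Rightarrow> real ^ 'a) \<Rightarrow> real ^ 'a \<Rightarrow> real ^ 'a" where
  "hodge m \<delta> f = \<delta> (wadjoint m \<delta> f) + wadjoint m \<delta> (\<delta> f)"

text \<open>\<open>heat m \<delta> t\<close> is $e^{-tH}$.\<close>

definition heat ::
  "('a::finite \<Rightarrow> real) \<Rightarrow> (real ^ 'a \<Rightarrow> real ^ 'a) \<Rightarrow> real \<Rightarrow> real ^ 'a \<Rightarrow> real ^ 'a" where
  "heat m \<delta> t = op_exp (\<lambda>f. (- t) *\<^sub>R hodge m \<delta> f)"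

section \<open>Cell complexes\<close>

definition covered :: "(real ^ 'a \<Rightarrow> real ^ 'a) \<Rightarrow> 'a::finite \<Rightarrow> 'a \<Rightarrow> bool" where
  "covered \<delta> x z \<longleftrightarrow> \<delta> (cell x) $ z \<noteq> 0"

text \<open>The partition of \<open>X\<close> into the sets \<open>X\<^sub>k\<close> is given by the dimension function \<open>cdim\<close>.\<close>

abbreviation cells :: "('a \<Rightarrow> nat) \<Rightarrow> nat \<Rightarrow> 'a set" where
  "cells cdim k \<equiv> {x. cdim x = k}"

locale cell_complex =
  fixes cdim :: "'a::finite \<Rightarrow> nat"
    and \<delta> :: "real ^ 'a \<Rightarrow> real ^ 'a"
    and m :: "'a \<Rightarrow> real"
  assumes linear_coboundary: "linear \<delta>"
    and weight_pos: "\<And>x. m x > 0"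
    and coboundary_values: "\<And>v z. \<delta> (cell v) $ z \<in> {-1, 0, 1}"
    and coboundary_dim: "\<And>v z. cdim z \<noteq> cdim v + 1 \<Longrightarrow> \<delta> (cell v) $ z = 0"
    and has_face: "\<And>z. cdim z \<ge> 1 \<Longrightarrow> \<exists>x. covered \<delta> x z"
    and edge_pos: "\<And>x. x \<in> cells cdim 1 \<Longrightarrow> \<exists>!w. w \<in> cells cdim 0 \<and> \<delta> (cell w) $ x = 1"
    and edge_neg: "\<And>x. x \<in> cells cdim 1 \<Longrightarrow> \<exists>!w. w \<in> cells cdim 0 \<and> \<delta> (cell w) $ x = -1"
    and diamond_card: "\<And>v z. cdim z = cdim v + 2 \<Longrightarrow> {x. covered \<delta> v x \<and> covered \<delta> x z} \<noteq> {} \<Longrightarrow>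
          card {x. covered \<delta> v x \<and> covered \<delta> x z} = 2"
    and diamond_sign: "\<And>v z. cdim z = cdim v + 2 \<Longrightarrow> {x. covered \<delta> v x \<and> covered \<delta> x z} \<noteq> {} \<Longrightarrow>
          {-1, 1} \<subseteq> {\<delta> (cell v) $ x * \<delta> (cell x) $ z | x. True}"
    and boundary_connected: "\<And>z x y. cdim z \<ge> 2 \<Longrightarrow> covered \<delta> x z \<Longrightarrow> covered \<delta> y z \<Longrightarrow>
          \<exists>(n::nat) s. s 0 = x \<and> s n = y \<and>
            (\<forall>i\<le>n. s i \<in> {u. covered \<delta> u z} \<union> {v. \<exists>u. covered \<delta> v u \<and> covered \<delta> u z}) \<and>
            (\<forall>i\<in>{1..n}. \<delta> (cell (s i)) $ s (i - 1) + \<delta> (cell (s (i - 1))) $ s i \<noteq> 0)"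
    and boundary_unique: "\<And>z z'. {x. covered \<delta> x z} = {x. covered \<delta> x z'} \<Longrightarrow> cdim z \<ge> 1 \<Longrightarrow> z = z'"

section \<open>Non-degenerate weights\<close>

definition edge_between ::
  "('a::finite \<Rightarrow> nat) \<Rightarrow> (real ^ 'a \<Rightarrow> real ^ 'a) \<Rightarrow> 'a \<Rightarrow> 'a \<Rightarrow> 'a \<Rightarrow> bool" where
  "edge_between cdim \<delta> x v w \<longleftrightarrow> x \<in> cells cdim 1 \<and> {u. covered \<delta> u x} = {v, w}"

definition adj ::
  "('a::finite \<Rightarrow> nat) \<Rightarrow> (real ^ 'a \<Rightarrow> real ^ 'a) \<Rightarrow> 'a \<Rightarrow> 'a \<Rightarrow> bool" where
  "adj cdim \<delta> v w \<longleftrightarrow> (\<exists>x. edge_between cdim \<delta> x v w)"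

text \<open>In a cell complex an edge is determined by its two vertices, so the description below is
  proper whenever \<open>v\<close> and \<open>w\<close> are adjacent.\<close>

definition edge_weight ::
  "('a::finite \<Rightarrow> nat) \<Rightarrow> (real ^ 'a \<Rightarrow> real ^ 'a) \<Rightarrow> ('a \<Rightarrow> real) \<Rightarrow> 'a \<Rightarrow> 'a \<Rightarrow> real" where
  "edge_weight cdim \<delta> \<omega> v w = \<omega> (THE x. edge_between cdim \<delta> x v w)"

text \<open>A path is the nonempty list of its vertices.\<close>

definition vpath ::
  "('a::finite \<Rightarrow> nat) \<Rightarrow> (real ^ 'a \<Rightarrow> real ^ 'a) \<Rightarrow> 'a \<Rightarrow> 'a \<Rightarrow> 'a list \<Rightarrow> bool" where
  "vpath cdim \<delta> v w p \<longleftrightarrow> p \<noteq> [] \<and> set p \<subseteq> cells cdim 0 \<and> hd p = v \<and> last p = w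
     \<and> successively (adj cdim \<delta>) p"

definition vpath_length ::
  "('a::finite \<Rightarrow> nat) \<Rightarrow> (real ^ 'a \<Rightarrow> real ^ 'a) \<Rightarrow> ('a \<Rightarrow> real) \<Rightarrow> 'a list \<Rightarrow> real" where
  "vpath_length cdim \<delta> \<omega> p = (\<Sum>i<length p - 1. edge_weight cdim \<delta> \<omega> (p ! i) (p ! Suc i))"

text \<open>The distance is extended-valued: \<open>\<infinity>\<close> for vertices not joined by a path.\<close>

definition vdist ::
  "('a::finite \<Rightarrow> nat) \<Rightarrow> (real ^ 'a \<Rightarrow> real ^ 'a) \<Rightarrow> ('a \<Rightarrow> real) \<Rightarrow> 'a \<Rightarrow> 'a \<Rightarrow> ereal" where
  "vdist cdim \<delta> \<omega> v w = (INF p \<in> {p. vpath cdim \<delta> v w p}. ereal (vpath_length cdim \<delta> \<omega> p))"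

definition non_degenerate ::
  "('a::finite \<Rightarrow> nat) \<Rightarrow> (real ^ 'a \<Rightarrow> real ^ 'a) \<Rightarrow> ('a \<Rightarrow> real) \<Rightarrow> bool" where
  "non_degenerate cdim \<delta> \<omega> \<longleftrightarrow>
     (\<forall>x v w. edge_between cdim \<delta> x v w \<longrightarrow>
        {p. vpath cdim \<delta> v w p \<and> ereal (vpath_length cdim \<delta> \<omega> p) = vdist cdim \<delta> \<omega> v w} = {[v, w]})"

section \<open>Curvature, norms, diagonal dominance\<close>

definition forman_curv ::
  "('a::finite \<Rightarrow> real) \<Rightarrow> (real ^ 'a \<Rightarrow> real ^ 'a) \<Rightarrow> ('a \<Rightarrow> real) \<Rightarrow> 'a \<Rightarrow> real" where
  "forman_curv m \<delta> \<omega> x =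
     hodge m \<delta> (cell x) $ x - (\<Sum>y\<in>UNIV - {x}. \<omega> y / \<omega> x * \<bar>hodge m \<delta> (cell y) $ x\<bar>)"

definition lp_norm :: "('a::finite \<Rightarrow> real) \<Rightarrow> real \<Rightarrow> real ^ 'a \<Rightarrow> real" where
  "lp_norm m p g = (\<Sum>x\<in>UNIV. m x * \<bar>g $ x\<bar> powr p) powr (1 / p)"

text \<open>Intended for \<open>1 \<le> p \<le> \<infinity>\<close>.\<close>

definition wnorm ::
  "('a::finite \<Rightarrow> real) \<Rightarrow> ('a \<Rightarrow> real) \<Rightarrow> ereal \<Rightarrow> real ^ 'a \<Rightarrow> real" where
  "wnorm m \<omega> p f =
     (if p = \<infinity> then Max (range (\<lambda>x. \<bar>f $ x / \<omega> x\<bar>))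
      else lp_norm m (real_of_ereal p) (\<chi> x. \<omega> x powr (2 / real_of_ereal p - 1) * f $ x))"

text \<open>Operators on \<open>C(Y)\<close> are given by maps on \<open>C(X)\<close> of which only the restriction to \<open>C(Y)\<close>
  matters.\<close>

definition selfadjoint_on ::
  "('a::finite \<Rightarrow> real) \<Rightarrow> 'a set \<Rightarrow> (real ^ 'a \<Rightarrow> real ^ 'a) \<Rightarrow> bool" where
  "selfadjoint_on m Y A \<longleftrightarrow>
     A ` fun_space Y \<subseteq> fun_space Y \<and>
     (\<forall>f\<in>fun_space Y. \<forall>g\<in>fun_space Y. A (f + g) = A f + A g) \<and>
     (\<forall>f\<in>fun_space Y. \<forall>c. A (c *\<^sub>R f) = c *\<^sub>R A f) \<and>
     (\<forall>f\<in>fun_space Y. \<forall>g\<in>fun_space Y. scalar_prod m (A f) g = scalar_prod m f (A g))"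

definition diag_dominant ::
  "('a::finite \<Rightarrow> real) \<Rightarrow> ('a \<Rightarrow> real) \<Rightarrow> 'a set \<Rightarrow> (real ^ 'a \<Rightarrow> real ^ 'a) \<Rightarrow> bool" where
  "diag_dominant m \<omega> Y A \<longleftrightarrow>
     selfadjoint_on m Y A \<and>
     (\<forall>x\<in>Y. \<omega> x * A (cell x) $ x \<ge> (\<Sum>y\<in>Y - {x}. \<omega> y * \<bar>A (cell y) $ x\<bar>))"

end

theory Submission
  imports Defs
begin

text \<open>
  Since \<open>H\<close> preserves dimension, the curvature bound is diagonal dominance of \<open>H\<^sub>k - R\<close> divided by
  \<open>\<omega>\<close>. For large \<open>s\<close> it says that \<open>s - H\<close> has \<open>(\<omega>,\<infinity>)\<close>-operator norm at most \<open>s - R\<close> on \<open>C(X\<^sub>k)\<close>,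
  and $e^{-tH} = e^{-ts} e^{t(s-H)}$ gives the estimate for \<open>p = \<infinity>\<close>. As $e^{-tH}$ is selfadjoint,
  that estimate bounds both the row and the column sums of its kernel, and Schur's test yields every
  \<open>p < \<infinity>\<close>. Conversely, differentiating the \<open>p = \<infinity>\<close> estimate at \<open>t = 0\<close>, for a function whose signs
  are opposite to those of a row of \<open>H\<close>, recovers the curvature bound.
\<close>

section \<open>The exponential of an operator\<close>

lemma linear_funpow: "linear T \<Longrightarrow> linear (T ^^ n)"
  for T :: "'b::real_vector \<Rightarrow> 'b"
proof (induction n)
  case 0
  then show ?case by (simp add: linear_id[unfolded id_def] id_def)
next
  case (Suc n)
  then show ?case unfolding funpow.simps by (intro linear_compose)
qed

lemma funpow_scaleR:
  fixes T :: "'b::real_vector \<Rightarrow> 'b"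
  assumes "linear T"
  shows "((\<lambda>f. c *\<^sub>R T f) ^^ n) f = c ^ n *\<^sub>R (T ^^ n) f"
  by (induction n) (simp_all add: linear_cmul[OF assms])

text \<open>In finite dimension \<open>T\<close> is bounded by some \<open>B\<close>, so the real
  exponential series of \<open>B\<close> dominates.\<close>

lemma op_exp_summable_norm:
  fixes T :: "'b::euclidean_space \<Rightarrow> 'b"
  assumes "linear T"
  shows "summable (\<lambda>n. norm ((T ^^ n) f /\<^sub>R fact n))"
proof -
  obtain B where B: "B > 0" "\<And>x. norm (T x) \<le> B * norm x"
    using linear_bounded_pos[OF assms] by blast
  have bound: "norm ((T ^^ n) f) \<le> B ^ n * norm f" for n
  proof (induction n)
    case (Suc n)
    have "norm ((T ^^ Suc n) f) \<le> B * norm ((T ^^ n) f)" using B by simp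
    also have "\<dots> \<le> B * (B ^ n * norm f)" using Suc B by (intro mult_left_mono) auto
    finally show ?case by (simp add: mult.assoc)
  qed simp
  have "summable (\<lambda>n. (B ^ n /\<^sub>R fact n) * norm f)"
    by (intro summable_mult2 summable_exp_generic)
  then show ?thesis
  proof (rule summable_comparison_test'[where N = 0])
    fix n
    show "norm (norm ((T ^^ n) f /\<^sub>R fact n)) \<le> (B ^ n /\<^sub>R fact n) * norm f"
      using bound[of n] by (simp add: divide_simps)
  qed
qed

lemma op_exp_sums:
  fixes T :: "'b::euclidean_space \<Rightarrow> 'b"
  assumes "linear T"
  shows "(\<lambda>n. (T ^^ n) f /\<^sub>R fact n) sums op_exp T f"
  unfolding op_exp_def
  using summable_norm_cancel[OF op_exp_summable_norm[OF assms]] by (rule summable_sums)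

lemma op_exp_sums_nth:
  fixes T :: "real ^ 'a::finite \<Rightarrow> real ^ 'a"
  assumes "linear T"
  shows "(\<lambda>n. (T ^^ n) f $ x / fact n) sums (op_exp T f $ x)"
  using sums_vec_nth[OF op_exp_sums[OF assms], of f x] by (simp add: divide_inverse mult.commute)

lemma linear_op_exp:
  fixes T :: "'b::euclidean_space \<Rightarrow> 'b"
  assumes "linear T"
  shows "linear (op_exp T)"
proof (rule linearI)
  note pow = linear_funpow[OF assms]
  fix f g
  have "(\<lambda>n. (T ^^ n) (f + g) /\<^sub>R fact n) sums (op_exp T f + op_exp T g)"
    using sums_add[OF op_exp_sums[OF assms] op_exp_sums[OF assms]]
    by (simp add: linear_add[OF pow] scaleR_add_right)
  then show "op_exp T (f + g) = op_exp T f + op_exp T g"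
    using op_exp_sums[OF assms] sums_unique2 by blast
next
  note pow = linear_funpow[OF assms]
  fix c :: real and f
  have "(\<lambda>n. (T ^^ n) (c *\<^sub>R f) /\<^sub>R fact n) sums (c *\<^sub>R op_exp T f)"
    using sums_scaleR_right[OF op_exp_sums[OF assms], of c f]
    by (simp add: linear_cmul[OF pow] mult.commute)
  then show "op_exp T (c *\<^sub>R f) = c *\<^sub>R op_exp T f"
    using op_exp_sums[OF assms] sums_unique2 by blast
qed

text \<open>The binomial theorem for the commuting maps \<open>a\<close> and \<open>T\<close>.
  Dividing by \<open>fact n\<close> makes the coefficients those of a Cauchy product of two
  exponential series.\<close>

lemma funpow_scaleR_add:
  fixes T :: "'b::real_vector \<Rightarrow> 'b"
  assumes "linear T"
  shows "((\<lambda>g. a *\<^sub>R g + T g) ^^ n) f /\<^sub>R fact n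
    = (\<Sum>i\<le>n. (a ^ i / fact i) *\<^sub>R ((T ^^ (n - i)) f /\<^sub>R fact (n - i)))"
proof (induction n)
  case 0
  then show ?case by simp
next
  case (Suc n)
  define A S where "A i = a ^ i / fact i" and "S i = (T ^^ i) f /\<^sub>R fact i" for i
  have A: "a * A i = real (Suc i) * A (Suc i)" for i
    by (simp add: A_def del: of_nat_Suc)
  have S: "T (S i) = real (Suc i) *\<^sub>R S (Suc i)" for i
    by (simp add: S_def linear_cmul[OF assms] del: of_nat_Suc)
  \<comment> \<open>The factor \<open>Suc n\<close> clears the new factor of the factorial. It is
    later split as \<open>i + (Suc n - i)\<close>: the first part comes from raising the power of
    \<open>a\<close>, the second from raising that of \<open>T\<close>.\<close>
  have "real (Suc n) *\<^sub>R (((\<lambda>g. a *\<^sub>R g + T g) ^^ Suc n) f /\<^sub>R fact (Suc n))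
      = a *\<^sub>R (((\<lambda>g. a *\<^sub>R g + T g) ^^ n) f /\<^sub>R fact n) + T (((\<lambda>g. a *\<^sub>R g + T g) ^^ n) f /\<^sub>R fact n)"
    by (simp add: linear_cmul[OF assms] scaleR_add_right divide_simps mult.commute del: of_nat_Suc)
  also have "\<dots> = (\<Sum>i\<le>n. (a * A i) *\<^sub>R S (n - i)) + (\<Sum>i\<le>n. A i *\<^sub>R T (S (n - i)))"
    unfolding Suc A_def[symmetric] S_def[symmetric]
    by (simp add: linear_sum[OF assms] linear_cmul[OF assms] scaleR_sum_right)
  also have "\<dots> = (\<Sum>i\<le>n. (real (Suc i) * A (Suc i)) *\<^sub>R S (n - i))
      + (\<Sum>i\<le>n. (real (Suc n - i) * A i) *\<^sub>R S (Suc n - i))"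
    by (simp add: A S Suc_diff_le mult.commute del: of_nat_Suc)
  \<comment> \<open>Both sums may run to \<open>Suc n\<close>: the new terms, at
    \<open>i = 0\<close> after the shift here and at \<open>i = Suc n\<close> below, have
    coefficient zero.\<close>
  also have "(\<Sum>i\<le>n. (real (Suc i) * A (Suc i)) *\<^sub>R S (n - i))
      = (\<Sum>i\<le>Suc n. (real i * A i) *\<^sub>R S (Suc n - i))"
    by (subst sum.atMost_Suc_shift) simp
  also have "(\<Sum>i\<le>n. (real (Suc n - i) * A i) *\<^sub>R S (Suc n - i))
      = (\<Sum>i\<le>Suc n. (real (Suc n - i) * A i) *\<^sub>R S (Suc n - i))"
    by simp
  also have "(\<Sum>i\<le>Suc n. (real i * A i) *\<^sub>R S (Suc n - i)) + \<dots>
      = (\<Sum>i\<le>Suc n. real (Suc n) *\<^sub>R (A i *\<^sub>R S (Suc n - i)))"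
    unfolding sum.distrib[symmetric]
  proof (rule sum.cong)
    fix i assume "i \<in> {..Suc n}"
    then have "real (Suc n) = real i + real (Suc n - i)" by simp
    then show "(real i * A i) *\<^sub>R S (Suc n - i) + (real (Suc n - i) * A i) *\<^sub>R S (Suc n - i)
        = real (Suc n) *\<^sub>R (A i *\<^sub>R S (Suc n - i))"
      by (simp only: scaleR_scaleR scaleR_add_left[symmetric] distrib_right)
  qed simp
  also have "\<dots> = real (Suc n) *\<^sub>R (\<Sum>i\<le>Suc n. A i *\<^sub>R S (Suc n - i))"
    by (simp only: scaleR_right.sum)
  finally show ?case
    unfolding A_def S_def by (rule scaleR_left_imp_eq[rotated]) (simp del: of_nat_Suc)
qed

text \<open>In each coordinate both factors are absolutely convergent real series, and the binomial
  expansion above is their Cauchy product.\<close>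

lemma op_exp_scaleR_add:
  fixes T :: "real ^ 'a::finite \<Rightarrow> real ^ 'a"
  assumes "linear T"
  shows "op_exp (\<lambda>g. a *\<^sub>R g + T g) f = exp a *\<^sub>R op_exp T f"
proof (rule vec_eq_iff[THEN iffD2], rule allI)
  fix x
  have lin: "linear (\<lambda>g. a *\<^sub>R g + T g)"
    by (intro linear_compose_add linear_scaleR assms)
  have a: "summable (\<lambda>n. norm (a ^ n / fact n))"
    using summable_norm_exp[of a] by (simp add: field_simps)
  have b: "summable (\<lambda>n. norm ((T ^^ n) f $ x / fact n))"
    using op_exp_summable_norm[OF assms, of f]
  proof (rule summable_comparison_test'[where N = 0])
    show "norm (norm ((T ^^ n) f $ x / fact n)) \<le> norm ((T ^^ n) f /\<^sub>R fact n)" for n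
      using component_le_norm_cart[of "(T ^^ n) f /\<^sub>R fact n" x] by (simp add: divide_inverse mult.commute)
  qed
  have "(\<lambda>n. (\<Sum>i\<le>n. (a ^ i / fact i) * ((T ^^ (n - i)) f $ x / fact (n - i))))
      sums ((\<Sum>n. a ^ n / fact n) * (\<Sum>n. (T ^^ n) f $ x / fact n))"
    using Cauchy_product_sums[OF a b] .
  moreover have "(\<Sum>n. (T ^^ n) f $ x / fact n) = op_exp T f $ x"
    using op_exp_sums_nth[OF assms] sums_unique by metis
  moreover have "(\<Sum>n. a ^ n / fact n) = exp a"
    by (simp add: exp_def field_simps)
  moreover have "((\<lambda>g. a *\<^sub>R g + T g) ^^ n) f $ x / fact n
      = (\<Sum>i\<le>n. (a ^ i / fact i) * ((T ^^ (n - i)) f $ x / fact (n - i)))" for n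
    using arg_cong[OF funpow_scaleR_add[OF assms, of n a f], of "\<lambda>v. v $ x"]
    by (simp add: divide_inverse mult_ac)
  ultimately have "(\<lambda>n. ((\<lambda>g. a *\<^sub>R g + T g) ^^ n) f $ x / fact n) sums (exp a * op_exp T f $ x)"
    by simp
  then show "op_exp (\<lambda>g. a *\<^sub>R g + T g) f $ x = (exp a *\<^sub>R op_exp T f) $ x"
    using op_exp_sums_nth[OF lin, of f x] sums_unique2 by fastforce
qed

text \<open>Each coordinate is a power series in \<open>t\<close> converging everywhere, so its
  derivative at 0 is its coefficient of index 1.\<close>

lemma has_real_derivative_op_exp_0:
  fixes T :: "real ^ 'a::finite \<Rightarrow> real ^ 'a"
  assumes "linear T"
  shows "((\<lambda>t. op_exp (\<lambda>g. t *\<^sub>R T g) f $ x) has_real_derivative T f $ x) (at 0)"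
proof -
  define c where "c n = (T ^^ n) f $ x / fact n" for n
  have lin: "linear (\<lambda>g. t *\<^sub>R T g)" for t
    by (intro linear_compose_scale_right assms)
  have sums: "(\<lambda>n. c n * t ^ n) sums (op_exp (\<lambda>g. t *\<^sub>R T g) f $ x)" for t
    using op_exp_sums_nth[OF lin, of t f x] by (simp add: c_def funpow_scaleR[OF assms] mult.commute)
  have "((\<lambda>t. \<Sum>n. c n * t ^ n) has_field_derivative (\<Sum>n. diffs c n * 0 ^ n)) (at 0)"
    by (rule termdiffs_strong_converges_everywhere) (use sums in \<open>auto simp: sums_iff\<close>)
  moreover have "(\<Sum>n. diffs c n * 0 ^ n) = T f $ x"
    unfolding powser_zero by (simp add: diffs_def c_def)
  moreover have "(\<Sum>n. c n * t ^ n) = op_exp (\<lambda>g. t *\<^sub>R T g) f $ x" for t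
    using sums sums_unique by metis
  ultimately show ?thesis by simp
qed

section \<open>Matrix entries, invariant subspaces and the supremum bound for the
  exponential\<close>

lemma linear_nth_expansion:
  fixes T :: "real ^ 'a::finite \<Rightarrow> real ^ 'b"
  assumes "linear T"
  shows "T f $ x = (\<Sum>y\<in>UNIV. f $ y * T (cell y) $ x)"
proof -
  have "T f = T (\<Sum>y\<in>UNIV. f $ y *s axis y 1)" by (simp add: basis_expansion)
  then show ?thesis
    by (simp add: linear_sum[OF assms] linear_cmul[OF assms] scalar_mult_eq_scaleR)
qed

lemma op_exp_in_fun_space:
  assumes "linear T" and "\<And>f. f \<in> fun_space Y \<Longrightarrow> T f \<in> fun_space Y" and f: "f \<in> fun_space Y"
  shows "op_exp T f \<in> fun_space Y"
proof -
  have pow: "(T ^^ n) f \<in> fun_space Y" for n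
    by (induction n) (simp_all add: assms)
  have "op_exp T f $ x = 0" if "x \<notin> Y" for x
  proof -
    have "(\<lambda>n. (T ^^ n) f $ x / fact n) = (\<lambda>n. 0)"
      using pow that by (auto simp: fun_space_def)
    then show ?thesis
      using op_exp_sums_nth[OF assms(1), of f x] sums_unique2[OF sums_zero] by metis
  qed
  then show ?thesis by (simp add: fun_space_def)
qed

text \<open>Iterating the row bound shows that the powers of \<open>T\<close> grow at most like
  \<open>C ^ n\<close> relative to \<open>\<omega>\<close>, so the exponential series of
  \<open>C\<close> dominates. The rows are controlled only on \<open>Y\<close>; invariance of C(Y)
  takes care of the other coordinates.\<close>

lemma op_exp_bound:
  assumes lin: "linear T" and inv: "\<And>f. f \<in> fun_space Y \<Longrightarrow> T f \<in> fun_space Y"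
    and \<omega>: "\<And>x. \<omega> x > 0"
    and row: "\<And>x. x \<in> Y \<Longrightarrow> (\<Sum>y\<in>UNIV. \<omega> y * \<bar>T (cell y) $ x\<bar>) \<le> C * \<omega> x"
    and f: "f \<in> fun_space Y" and M: "\<And>y. \<bar>f $ y\<bar> \<le> M * \<omega> y" and x: "x \<in> Y"
  shows "\<bar>op_exp T f $ x\<bar> \<le> exp C * M * \<omega> x"
proof -
  \<comment> \<open>Nonnegativity of \<open>C\<close> and \<open>M\<close> is not assumed: it
    follows from the two bounds at the given point \<open>x\<close> of \<open>Y\<close>, and the
    induction below multiplies inequalities by both.\<close>
  have "0 \<le> C * \<omega> x"
    using row[OF x] \<omega> by (smt (verit) sum_nonneg abs_ge_zero mult_nonneg_nonneg)
  then have C: "C \<ge> 0" using \<omega>[of x] by (simp add: zero_le_mult_iff)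
  have "0 \<le> M * \<omega> x" using M[of x] by linarith
  then have M0: "M \<ge> 0" using \<omega>[of x] by (simp add: zero_le_mult_iff)
  have inv': "(T ^^ n) f \<in> fun_space Y" for n
    by (induction n) (simp_all add: inv f)
  have bound: "\<bar>(T ^^ n) f $ y\<bar> \<le> C ^ n * M * \<omega> y" for n y
  proof (induction n arbitrary: y)
    case 0
    then show ?case using M by simp
  next
    case (Suc n)
    show ?case
    proof (cases "y \<in> Y")
      case True
      have "\<bar>(T ^^ Suc n) f $ y\<bar> \<le> (\<Sum>z\<in>UNIV. \<bar>(T ^^ n) f $ z\<bar> * \<bar>T (cell z) $ y\<bar>)"
        using linear_nth_expansion[OF lin, of "(T ^^ n) f" y] sum_abs[of "\<lambda>z. (T ^^ n) f $ z * T (cell z) $ y" UNIV]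
        by (simp add: abs_mult)
      also have "\<dots> \<le> (\<Sum>z\<in>UNIV. (C ^ n * M * \<omega> z) * \<bar>T (cell z) $ y\<bar>)"
        by (intro sum_mono mult_right_mono Suc) auto
      also have "\<dots> = C ^ n * M * (\<Sum>z\<in>UNIV. \<omega> z * \<bar>T (cell z) $ y\<bar>)"
        by (simp add: sum_distrib_left mult.assoc)
      also have "\<dots> \<le> C ^ n * M * (C * \<omega> y)"
        using row[OF True] C M0 by (intro mult_left_mono) auto
      finally show ?thesis by (simp add: mult_ac)
    next
      case False
      then have "(T ^^ Suc n) f $ y = 0" using inv'[of "Suc n"] by (simp add: fun_space_def)
      then show ?thesis using C M0 \<omega>[of y] by (simp del: funpow.simps)
    qed
  qed
  have "(\<lambda>n. (C ^ n /\<^sub>R fact n) * (M * \<omega> x)) sums (exp C * (M * \<omega> x))"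
    by (intro sums_mult2 exp_converges)
  then have e: "(\<lambda>n. C ^ n * M * \<omega> x / fact n) sums (exp C * M * \<omega> x)"
    by (simp add: divide_inverse mult_ac)
  have s: "(\<lambda>n. (T ^^ n) f $ x / fact n) sums (op_exp T f $ x)"
    using op_exp_sums_nth[OF lin] .
  have le: "\<bar>(T ^^ n) f $ x / fact n\<bar> \<le> C ^ n * M * \<omega> x / fact n" for n
    using bound[of n x] by (simp add: divide_right_mono)
  have "op_exp T f $ x \<le> exp C * M * \<omega> x"
    by (rule sums_le[OF _ s e]) (use le abs_le_D1 abs_le_D2 in blast)
  moreover have "- (op_exp T f $ x) \<le> exp C * M * \<omega> x"
    by (rule sums_le[OF _ sums_minus[OF s] e]) (use le abs_le_D1 abs_le_D2 in blast)
  ultimately show ?thesis by simp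
qed

section \<open>Weighted scalar products and norms\<close>

lemma scalar_prod_cell: "scalar_prod m f (cell x) = f $ x * m x"
  by (simp add: scalar_prod_def axis_def if_distrib if_distribR cong: if_cong)

lemma scalar_prod_commute: "scalar_prod m f g = scalar_prod m g f"
  by (simp add: scalar_prod_def mult_ac)

lemma scalar_prod_add_left: "scalar_prod m (f + g) h = scalar_prod m f h + scalar_prod m g h"
  by (simp add: scalar_prod_def distrib_right sum.distrib)

lemma scalar_prod_scaleR_left: "scalar_prod m (c *\<^sub>R f) h = c * scalar_prod m f h"
  by (simp add: scalar_prod_def sum_distrib_left mult.assoc)

text \<open>All powers of \<open>T\<close> are symmetric, and the pairing, a finite sum over
  coordinates, commutes with the series.\<close>

lemma op_exp_symmetric:
  assumes lin: "linear T" and sym: "\<And>f g. scalar_prod m (T f) g = scalar_prod m f (T g)"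
  shows "scalar_prod m (op_exp T f) g = scalar_prod m f (op_exp T g)"
proof -
  have pow: "scalar_prod m ((T ^^ n) f) g = scalar_prod m f ((T ^^ n) g)" for n f g
    by (induction n arbitrary: f g) (simp_all add: sym funpow_swap1)
  have sums: "(\<lambda>n. scalar_prod m ((T ^^ n) f) g / fact n) sums scalar_prod m (op_exp T f) g" for f g
  proof -
    have "(\<lambda>n. \<Sum>x\<in>UNIV. (T ^^ n) f $ x / fact n * (g $ x * m x))
        sums (\<Sum>x\<in>UNIV. op_exp T f $ x * (g $ x * m x))"
      by (intro sums_sum sums_mult2 op_exp_sums_nth lin)
    then show ?thesis
      by (simp add: scalar_prod_def sum_divide_distrib mult.assoc)
  qed
  have "scalar_prod m ((T ^^ n) g) f = scalar_prod m ((T ^^ n) f) g" for n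
    using pow[of n f g] scalar_prod_commute by metis
  then have "(\<lambda>n. scalar_prod m ((T ^^ n) f) g / fact n) sums scalar_prod m (op_exp T g) f"
    using sums[of g f] by simp
  then show ?thesis
    using sums[of f g] sums_unique2 scalar_prod_commute[of m "op_exp T g" f] by metis
qed

section \<open>Jensen's inequality, weighted norms and Schur's test\<close>

lemma axis_nth_neq: "x \<noteq> y \<Longrightarrow> axis y c $ x = 0"
  by (simp add: axis_def)

text \<open>Jensen's inequality for the convex function \<open>t powr r\<close>, with weights
  \<open>k\<close> of total mass at most \<open>c\<close> instead of exactly 1.\<close>

lemma sum_powr_le:
  fixes k g :: "'i \<Rightarrow> real"
  assumes "finite A" and k: "\<And>i. i \<in> A \<Longrightarrow> k i \<ge> 0" and g: "\<And>i. i \<in> A \<Longrightarrow> g i \<ge> 0"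
    and c: "(\<Sum>i\<in>A. k i) \<le> c" and r: "r \<ge> 1"
  shows "(\<Sum>i\<in>A. k i * g i) powr r \<le> c powr (r - 1) * (\<Sum>i\<in>A. k i * g i powr r)"
proof -
  \<comment> \<open>Only zero terms are discarded. On \<open>B\<close> convexity is applied at
    positive points, and the total mass \<open>S\<close> is positive when \<open>B\<close> is
    nonempty.\<close>
  define B where "B = {i \<in> A. k i > 0 \<and> g i > 0}"
  have B: "finite B" "B \<subseteq> A" using \<open>finite A\<close> by (auto simp: B_def)
  have zero: "k i * g i = 0 \<and> k i * g i powr r = 0" if "i \<in> A - B" for i
    using that k[of i] g[of i] by (force simp: B_def)
  have eq: "(\<Sum>i\<in>A. k i * g i) = (\<Sum>i\<in>B. k i * g i)"
    "(\<Sum>i\<in>A. k i * g i powr r) = (\<Sum>i\<in>B. k i * g i powr r)"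
    using zero B \<open>finite A\<close> by (auto intro!: sum.mono_neutral_right)
  show ?thesis
  proof (cases "B = {}")
    case True
    then show ?thesis using eq r by simp
  next
    case False
    define S where "S = (\<Sum>i\<in>B. k i)"
    have S: "S > 0" unfolding S_def using False B by (intro sum_pos) (auto simp: B_def)
    have "S \<le> c" unfolding S_def using B \<open>finite A\<close> k c by (smt (verit) sum_mono2 DiffD1)
    \<comment> \<open>The weights are normalized to \<open>k i / S\<close>. Undoing this leaves
      \<open>S powr (r - 1)\<close>, whose exponent is nonnegative, so \<open>S \<le> c\<close> can
      be used.\<close>
    have "(\<Sum>i\<in>B. (k i / S) *\<^sub>R g i) powr r \<le> (\<Sum>i\<in>B. (k i / S) * g i powr r)"
    proof (rule convex_on_sum[OF B(1) False powr_convex[OF r]])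
      show "(\<Sum>i\<in>B. k i / S) = 1" using S by (simp add: S_def sum_divide_distrib[symmetric])
    qed (use S in \<open>auto simp: B_def\<close>)
    then have jensen: "((\<Sum>i\<in>B. k i * g i) / S) powr r \<le> (\<Sum>i\<in>B. k i * g i powr r) / S"
      by (simp add: sum_divide_distrib)
    have nn: "0 \<le> (\<Sum>i\<in>B. k i * g i)" "0 \<le> (\<Sum>i\<in>B. k i * g i powr r)"
      by (auto intro!: sum_nonneg simp: B_def)
    have "(\<Sum>i\<in>B. k i * g i) powr r = S powr r * ((\<Sum>i\<in>B. k i * g i) / S) powr r"
      using S nn by (simp add: powr_divide)
    also have "\<dots> \<le> S powr r * ((\<Sum>i\<in>B. k i * g i powr r) / S)"
      using jensen by (intro mult_left_mono) auto
    also have "\<dots> = S powr (r - 1) * (\<Sum>i\<in>B. k i * g i powr r)"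
      using S by (simp add: powr_diff)
    also have "\<dots> \<le> c powr (r - 1) * (\<Sum>i\<in>B. k i * g i powr r)"
      using S \<open>S \<le> c\<close> r nn by (intro mult_right_mono powr_mono2) auto
    finally show ?thesis using eq by simp
  qed
qed

lemma wnorm_infinity_le_iff:
  assumes "\<And>x. \<omega> x > 0"
  shows "wnorm m \<omega> \<infinity> f \<le> M \<longleftrightarrow> (\<forall>x. \<bar>f $ x\<bar> \<le> M * \<omega> x)"
  using assms abs_of_pos[OF assms] by (simp add: wnorm_def pos_divide_le_eq)

lemma abs_le_wnorm_infinity:
  assumes "\<And>x. \<omega> x > 0"
  shows "\<bar>f $ x\<bar> \<le> wnorm m \<omega> \<infinity> f * \<omega> x"
  using wnorm_infinity_le_iff[where \<omega> = \<omega>, OF assms, of m f "wnorm m \<omega> \<infinity> f"] by simp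

text \<open>The \<open>\<omega>\<close>-weighted \<open>\<ell>\<^sup>p\<close>-norm of \<open>f\<close> is the unweighted norm of \<open>f / \<omega>\<close> for the measure \<open>m \<omega>\<^sup>2\<close>.\<close>

lemma wnorm_ereal:
  assumes \<omega>: "\<And>x. \<omega> x > 0" and r: "r \<ge> 1"
  shows "wnorm m \<omega> (ereal r) f
    = (\<Sum>x\<in>UNIV. m x * (\<omega> x)\<^sup>2 * (\<bar>f $ x\<bar> / \<omega> x) powr r) powr (1 / r)"
proof -
  have "\<bar>\<omega> x powr (2 / r - 1) * f $ x\<bar> powr r = (\<omega> x)\<^sup>2 * (\<bar>f $ x\<bar> / \<omega> x) powr r" for x
  proof -
    have "\<bar>\<omega> x powr (2 / r - 1) * f $ x\<bar> powr r = \<omega> x powr ((2 / r - 1) * r) * \<bar>f $ x\<bar> powr r"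
      by (simp add: abs_mult powr_mult powr_powr)
    also have "(2 / r - 1) * r = 2 - r" using r by (simp add: field_simps)
    also have "\<omega> x powr (2 - r) * \<bar>f $ x\<bar> powr r = (\<omega> x)\<^sup>2 * (\<bar>f $ x\<bar> / \<omega> x) powr r"
      using \<omega>[of x] by (simp add: powr_diff powr_divide)
    finally show ?thesis .
  qed
  then show ?thesis by (simp add: wnorm_def lp_norm_def mult.assoc)
qed

text \<open>On the quotient \<open>f / \<omega>\<close> the operator acts with kernel
  \<open>\<omega> y * E (cell y) $ x / \<omega> x\<close>. Jensen along the rows costs
  \<open>c powr (r - 1)\<close>. Symmetry of \<open>E\<close> makes the column sums for the measure
  \<open>m \<omega>^2\<close> row sums again, which supplies the last factor
  \<open>c\<close>.\<close>

lemma schur_test: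
  assumes m: "\<And>x. m x > 0" and \<omega>: "\<And>x. \<omega> x > 0" and c: "c > 0" and r: "r \<ge> 1"
    and lin: "linear E" and sym: "\<And>f g. scalar_prod m (E f) g = scalar_prod m f (E g)"
    and inv: "\<And>f. f \<in> fun_space Y \<Longrightarrow> E f \<in> fun_space Y"
    and row: "\<And>x. x \<in> Y \<Longrightarrow> (\<Sum>y\<in>Y. \<omega> y * \<bar>E (cell y) $ x\<bar>) \<le> c * \<omega> x"
    and f: "f \<in> fun_space Y"
  shows "wnorm m \<omega> (ereal r) (E f) \<le> c * wnorm m \<omega> (ereal r) f"
proof -
  define G where "G y = (\<bar>f $ y\<bar> / \<omega> y) powr r" for y
  have G: "G y \<ge> 0" for y by (simp add: G_def)
  \<comment> \<open>Symmetry tested on two cells: the matrix itself need not be symmetric, only its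
    product with the weight \<open>m\<close>.\<close>
  have kernel_sym: "E (cell y) $ x * m x = E (cell x) $ y * m y" for x y
    using sym[of "cell y" "cell x"] scalar_prod_commute[of m "cell y"] by (simp add: scalar_prod_cell)
  have restrict: "(\<Sum>x\<in>UNIV. m x * (\<omega> x)\<^sup>2 * (\<bar>h $ x\<bar> / \<omega> x) powr r)
      = (\<Sum>x\<in>Y. m x * (\<omega> x)\<^sup>2 * (\<bar>h $ x\<bar> / \<omega> x) powr r)" if "h \<in> fun_space Y" for h
    using that r by (intro sum.mono_neutral_right) (auto simp: fun_space_def)
  have pointwise: "(\<bar>E f $ x\<bar> / \<omega> x) powr r
      \<le> c powr (r - 1) * (\<Sum>y\<in>Y. \<omega> y * \<bar>E (cell y) $ x\<bar> / \<omega> x * G y)" if x: "x \<in> Y" for x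
  proof -
    have "E f $ x = (\<Sum>y\<in>Y. f $ y * E (cell y) $ x)"
      unfolding linear_nth_expansion[OF lin, of f x]
      using f by (intro sum.mono_neutral_right) (auto simp: fun_space_def)
    then have "\<bar>E f $ x\<bar> \<le> (\<Sum>y\<in>Y. \<bar>f $ y\<bar> * \<bar>E (cell y) $ x\<bar>)"
      using sum_abs[of "\<lambda>y. f $ y * E (cell y) $ x" Y] by (simp add: abs_mult)
    then have "\<bar>E f $ x\<bar> / \<omega> x \<le> (\<Sum>y\<in>Y. \<bar>f $ y\<bar> * \<bar>E (cell y) $ x\<bar>) / \<omega> x"
      using \<omega>[of x] by (simp add: divide_right_mono)
    also have "\<dots> = (\<Sum>y\<in>Y. (\<omega> y * \<bar>E (cell y) $ x\<bar> / \<omega> x) * (\<bar>f $ y\<bar> / \<omega> y))"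
      unfolding sum_divide_distrib using \<omega> less_imp_neq[OF \<omega>]
      by (intro sum.cong) (auto simp: field_simps)
    finally have "(\<bar>E f $ x\<bar> / \<omega> x) powr r
        \<le> (\<Sum>y\<in>Y. (\<omega> y * \<bar>E (cell y) $ x\<bar> / \<omega> x) * (\<bar>f $ y\<bar> / \<omega> y)) powr r"
      using \<omega>[of x] r by (intro powr_mono2) auto
    also have "\<dots> \<le> c powr (r - 1) * (\<Sum>y\<in>Y. (\<omega> y * \<bar>E (cell y) $ x\<bar> / \<omega> x) * (\<bar>f $ y\<bar> / \<omega> y) powr r)"
    proof (rule sum_powr_le[OF _ _ _ _ r])
      show "(\<Sum>y\<in>Y. \<omega> y * \<bar>E (cell y) $ x\<bar> / \<omega> x) \<le> c"
        using row[OF x] \<omega>[of x] by (simp add: sum_divide_distrib[symmetric] divide_le_eq)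
    qed (use \<omega> less_imp_le[OF \<omega>] in auto)
    finally show ?thesis by (simp add: G_def)
  qed
  have "(\<Sum>x\<in>Y. m x * (\<omega> x)\<^sup>2 * (\<bar>E f $ x\<bar> / \<omega> x) powr r)
      \<le> (\<Sum>x\<in>Y. m x * (\<omega> x)\<^sup>2 * (c powr (r - 1) * (\<Sum>y\<in>Y. \<omega> y * \<bar>E (cell y) $ x\<bar> / \<omega> x * G y)))"
    using m less_imp_le[OF m] by (intro sum_mono mult_left_mono pointwise) auto
  also have "\<dots> = (\<Sum>x\<in>Y. \<Sum>y\<in>Y. c powr (r - 1) * (G y * \<omega> y * (\<omega> x * \<bar>E (cell y) $ x * m x\<bar>)))"
    unfolding sum_distrib_left
    using \<omega> less_imp_neq[OF \<omega>] m less_imp_le[OF m]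
    by (intro sum.cong refl) (simp add: abs_mult power2_eq_square field_simps)
  \<comment> \<open>After the exchange of sums, \<open>kernel_sym\<close> transposes the entry, so
    the inner sum over \<open>x\<close> becomes the row sum at \<open>y\<close>, to which
    \<open>row\<close> applies once more.\<close>
  also have "\<dots> = (\<Sum>y\<in>Y. \<Sum>x\<in>Y. c powr (r - 1) * (G y * \<omega> y * (\<omega> x * \<bar>E (cell x) $ y * m y\<bar>)))"
    by (subst sum.swap) (simp only: kernel_sym)
  also have "\<dots> = (\<Sum>y\<in>Y. c powr (r - 1) * (G y * \<omega> y * m y * (\<Sum>x\<in>Y. \<omega> x * \<bar>E (cell x) $ y\<bar>)))"
    unfolding sum_distrib_left using less_imp_le[OF m]
    by (intro sum.cong refl) (simp add: abs_mult mult_ac)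
  also have "\<dots> \<le> (\<Sum>y\<in>Y. c powr (r - 1) * (G y * \<omega> y * m y * (c * \<omega> y)))"
    using less_imp_le[OF m] less_imp_le[OF \<omega>] G
    by (intro sum_mono mult_left_mono row) auto
  also have "\<dots> = c powr r * (\<Sum>y\<in>Y. m y * (\<omega> y)\<^sup>2 * (\<bar>f $ y\<bar> / \<omega> y) powr r)"
    unfolding sum_distrib_left G_def using c
    by (intro sum.cong refl) (simp add: powr_diff power2_eq_square)
  finally have "(\<Sum>x\<in>UNIV. m x * (\<omega> x)\<^sup>2 * (\<bar>E f $ x\<bar> / \<omega> x) powr r)
      \<le> c powr r * (\<Sum>x\<in>UNIV. m x * (\<omega> x)\<^sup>2 * (\<bar>f $ x\<bar> / \<omega> x) powr r)"
    using restrict f inv by simp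
  then have "wnorm m \<omega> (ereal r) (E f)
      \<le> (c powr r * (\<Sum>x\<in>UNIV. m x * (\<omega> x)\<^sup>2 * (\<bar>f $ x\<bar> / \<omega> x) powr r)) powr (1 / r)"
    unfolding wnorm_ereal[where \<omega> = \<omega>, OF \<omega> r] using r less_imp_le[OF m]
    by (intro powr_mono2 sum_nonneg mult_nonneg_nonneg) auto
  also have "\<dots> = c * wnorm m \<omega> (ereal r) f"
    unfolding wnorm_ereal[where \<omega> = \<omega>, OF \<omega> r] using r c less_imp_le[OF m]
    by (subst powr_mult) (auto intro!: sum_nonneg simp: powr_powr)
  finally show ?thesis .
qed

section \<open>The Hodge Laplacian\<close>

text \<open>The choice in \<open>wadjoint\<close> is meaningful once some adjoint exists, so one is
  written down explicitly.\<close>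

lemma wadjoint_adjoint:
  fixes T :: "real ^ 'a::finite \<Rightarrow> real ^ 'a"
  assumes lin: "linear T" and m: "\<And>x. m x > 0"
  shows "scalar_prod m (T f) g = scalar_prod m f (wadjoint m T g)"
proof -
  \<comment> \<open>The formula is forced: pairing with \<open>cell y\<close> must give the scalar
    product of \<open>T (cell y)\<close> and \<open>g\<close>, and that pairing multiplies the value
    at \<open>y\<close> by \<open>m y\<close>.\<close>
  define T' :: "real ^ 'a \<Rightarrow> real ^ 'a"
    where "T' g = (\<chi> y. (\<Sum>x\<in>UNIV. T (cell y) $ x * g $ x * m x) / m y)" for g
  have "scalar_prod m (T f) g = scalar_prod m f (T' g)" for f g
  proof -
    have "scalar_prod m (T f) g = (\<Sum>x\<in>UNIV. \<Sum>y\<in>UNIV. f $ y * (T (cell y) $ x * g $ x * m x))"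
      unfolding scalar_prod_def linear_nth_expansion[OF lin, of f]
      by (simp add: sum_distrib_right mult.assoc)
    also have "\<dots> = (\<Sum>y\<in>UNIV. \<Sum>x\<in>UNIV. f $ y * (T (cell y) $ x * g $ x * m x))"
      by (rule sum.swap)
    also have "\<dots> = scalar_prod m f (T' g)"
      using less_imp_neq[OF m] unfolding scalar_prod_def T'_def
      by (intro sum.cong) (auto simp: sum_distrib_left[symmetric] dest: sym)
    finally show ?thesis .
  qed
  then have "\<exists>T'. \<forall>f g. scalar_prod m (T f) g = scalar_prod m f (T' g)" by blast
  then have "\<forall>f g. scalar_prod m (T f) g = scalar_prod m f (wadjoint m T g)"
    unfolding wadjoint_def by (rule someI_ex)
  then show ?thesis by blast
qed

text \<open>Testing the adjoint relation on a cell determines the chosen operator completely; its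
  linearity and its support are read off from this formula.\<close>

lemma wadjoint_nth:
  assumes "linear T" and m: "\<And>x. m x > 0"
  shows "wadjoint m T f $ x = scalar_prod m f (T (cell x)) / m x"
proof -
  have "scalar_prod m f (T (cell x)) = scalar_prod m (wadjoint m T f) (cell x)"
    using wadjoint_adjoint[where m = m, OF assms] scalar_prod_commute by metis
  then show ?thesis using m[of x] by (simp add: scalar_prod_cell)
qed

lemma linear_wadjoint:
  assumes "linear T" and "\<And>x. m x > 0"
  shows "linear (wadjoint m T)"
  by (rule linearI)
    (simp_all add: vec_eq_iff wadjoint_nth[where m = m, OF assms] scalar_prod_add_left scalar_prod_scaleR_left
      add_divide_distrib)

lemma linear_hodge:
  assumes "linear \<delta>" and "\<And>x. m x > 0"
  shows "linear (hodge m \<delta>)"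
proof -
  note l = linear_wadjoint[where m = m, OF assms]
  show ?thesis
    by (rule linearI)
      (simp_all add: hodge_def linear_add[OF l] linear_add[OF assms(1)] linear_cmul[OF l]
        linear_cmul[OF assms(1)] scaleR_add_right)
qed

text \<open>The bilinear form of the Laplacian. It is visibly symmetric, and it vanishes on two
  cells as soon as their boundaries and their coboundaries have disjoint supports.\<close>

lemma scalar_prod_hodge:
  assumes "linear \<delta>" and "\<And>x. m x > 0"
  shows "scalar_prod m (hodge m \<delta> f) g
    = scalar_prod m (wadjoint m \<delta> f) (wadjoint m \<delta> g) + scalar_prod m (\<delta> f) (\<delta> g)"
proof -
  note adj = wadjoint_adjoint[where m = m, OF assms]
  have "scalar_prod m (wadjoint m \<delta> (\<delta> f)) g = scalar_prod m (\<delta> f) (\<delta> g)"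
    using adj scalar_prod_commute by metis
  then show ?thesis by (simp add: hodge_def scalar_prod_add_left adj)
qed

lemma hodge_symmetric:
  assumes "linear \<delta>" and "\<And>x. m x > 0"
  shows "scalar_prod m (hodge m \<delta> f) g = scalar_prod m f (hodge m \<delta> g)"
  using scalar_prod_hodge[where m = m, OF assms, of f g] scalar_prod_hodge[where m = m, OF assms, of g f]
  by (simp add: scalar_prod_commute)

section \<open>Curvature and heat semigroup on a cell complex\<close>

context cell_complex
begin

text \<open>The coboundary of a cell lives one dimension above it and its image under the adjoint
  one dimension below. For cells of different dimension these supports are disjoint, so both terms
  of the bilinear form vanish.\<close>

lemma cdim_eq_if_hodge_nonzero:
  assumes "hodge m \<delta> (cell y) $ x \<noteq> 0"
  shows "cdim y = cdim x"
proof (rule ccontr)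
  assume neq: "cdim y \<noteq> cdim x"
  note lm = linear_coboundary weight_pos
  have "wadjoint m \<delta> (cell y) $ w * wadjoint m \<delta> (cell x) $ w = 0" for w
  proof (rule ccontr)
    assume "\<not> ?thesis"
    then have "\<delta> (cell w) $ y \<noteq> 0" "\<delta> (cell w) $ x \<noteq> 0"
      unfolding wadjoint_nth[where m = m, OF lm] scalar_prod_commute[of m "cell y"] scalar_prod_commute[of m "cell x"]
        scalar_prod_cell by auto
    then show False using coboundary_dim neq by metis
  qed
  moreover have "\<delta> (cell y) $ w * \<delta> (cell x) $ w = 0" for w
    using coboundary_dim[of w y] coboundary_dim[of w x] neq by fastforce
  ultimately have "scalar_prod m (hodge m \<delta> (cell y)) (cell x) = 0"
    unfolding scalar_prod_hodge[where m = m, OF lm] unfolding scalar_prod_def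
    by (simp only: mult_zero_left sum.neutral_const add_0)
  then show False using assms weight_pos[of x] by (simp add: scalar_prod_cell)
qed

lemma hodge_in_fun_space:
  assumes "f \<in> fun_space (cells cdim k)"
  shows "hodge m \<delta> f \<in> fun_space (cells cdim k)"
proof -
  have "hodge m \<delta> f $ x = 0" if "cdim x \<noteq> k" for x
    unfolding linear_nth_expansion[OF linear_hodge[where m = m, OF linear_coboundary weight_pos], of f x]
    using assms that by (intro sum.neutral) (auto simp: fun_space_def dest: cdim_eq_if_hodge_nonzero)
  then show ?thesis by (simp add: fun_space_def)
qed

text \<open>Cells of other dimensions contribute nothing to the row at \<open>x\<close>, and the
  positive factor \<open>\<omega> x\<close> can be cleared. In this form the curvature bound is
  compared with dominance and with the semigroup estimates.\<close>

lemma forman_curv_ge_iff: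
  assumes "\<And>x. \<omega> x > 0" and "cdim x = k"
  shows "forman_curv m \<delta> \<omega> x \<ge> R \<longleftrightarrow>
    (\<Sum>y\<in>cells cdim k - {x}. \<omega> y * \<bar>hodge m \<delta> (cell y) $ x\<bar>) \<le> (hodge m \<delta> (cell x) $ x - R) * \<omega> x"
proof -
  have "(\<Sum>y\<in>UNIV - {x}. \<omega> y / \<omega> x * \<bar>hodge m \<delta> (cell y) $ x\<bar>)
      = (\<Sum>y\<in>cells cdim k - {x}. \<omega> y / \<omega> x * \<bar>hodge m \<delta> (cell y) $ x\<bar>)"
    using assms(2) by (intro sum.mono_neutral_right) (auto dest: cdim_eq_if_hodge_nonzero)
  also have "\<dots> = (\<Sum>y\<in>cells cdim k - {x}. \<omega> y * \<bar>hodge m \<delta> (cell y) $ x\<bar>) / \<omega> x"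
    by (simp add: sum_divide_distrib)
  finally show ?thesis
    unfolding forman_curv_def using assms(1)[of x]
    by (simp add: le_diff_eq add.commute flip: pos_divide_le_eq)
qed

text \<open>Subtracting \<open>R\<close> lowers each diagonal entry by \<open>R\<close> and leaves
  the others unchanged, so the row inequalities coincide; selfadjointness comes from the symmetry
  and the dimension invariance of H.\<close>

lemma forman_curv_ge_iff_diag_dominant:
  assumes \<omega>: "\<And>x. \<omega> x > 0"
  shows "(\<forall>x\<in>cells cdim k. forman_curv m \<delta> \<omega> x \<ge> R) \<longleftrightarrow>
    diag_dominant m \<omega> (cells cdim k) (\<lambda>f. hodge m \<delta> f - R *\<^sub>R f)"
proof -
  note lm = linear_coboundary weight_pos
  note lin = linear_hodge[where m = m, OF lm]
  have sa: "selfadjoint_on m (cells cdim k) (\<lambda>f. hodge m \<delta> f - R *\<^sub>R f)"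
    unfolding selfadjoint_on_def
  proof (intro conjI ballI allI)
    show "(\<lambda>f. hodge m \<delta> f - R *\<^sub>R f) ` fun_space (cells cdim k) \<subseteq> fun_space (cells cdim k)"
      using hodge_in_fun_space by (auto simp: fun_space_def)
    show "scalar_prod m (hodge m \<delta> f - R *\<^sub>R f) g = scalar_prod m f (hodge m \<delta> g - R *\<^sub>R g)" for f g
    proof -
      have "scalar_prod m (hodge m \<delta> f' - R *\<^sub>R f') g'
          = scalar_prod m (hodge m \<delta> f') g' - R * scalar_prod m f' g'" for f' g'
        using scalar_prod_add_left[of m "hodge m \<delta> f'" "(- R) *\<^sub>R f'" g']
        unfolding scalar_prod_scaleR_left by simp
      then show ?thesis
        using hodge_symmetric[where m = m, OF lm, of f g] scalar_prod_commute by metis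
    qed
  qed (simp_all add: linear_add[OF lin] linear_cmul[OF lin] algebra_simps)
  have offdiag: "(\<Sum>y\<in>cells cdim k - {x}. \<omega> y * \<bar>(hodge m \<delta> (cell y) - R *\<^sub>R cell y) $ x\<bar>)
      = (\<Sum>y\<in>cells cdim k - {x}. \<omega> y * \<bar>hodge m \<delta> (cell y) $ x\<bar>)" for x
    by (intro sum.cong) (auto simp: axis_def)
  have diag: "\<omega> x * (hodge m \<delta> (cell x) - R *\<^sub>R cell x) $ x = (hodge m \<delta> (cell x) $ x - R) * \<omega> x" for x
    by (simp add: mult.commute)
  show ?thesis
    unfolding diag_dominant_def offdiag diag using sa forman_curv_ge_iff[where \<omega> = \<omega>, OF \<omega>] by auto
qed

text \<open>Shifting by a large \<open>s\<close> makes the diagonal of \<open>s - H\<close> nonnegative, so that the curvature bound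
  says exactly that its weighted absolute row sums are at most \<open>s - R\<close>.\<close>

lemma heat_contraction_infinity:
  assumes \<omega>: "\<And>x. \<omega> x > 0" and F: "\<And>x. x \<in> cells cdim k \<Longrightarrow> forman_curv m \<delta> \<omega> x \<ge> R"
    and f: "f \<in> fun_space (cells cdim k)" and t: "t \<ge> 0"
  shows "wnorm m \<omega> \<infinity> (heat m \<delta> t f) \<le> exp (- R * t) * wnorm m \<omega> \<infinity> f"
proof -
  note lin = linear_hodge[where m = m, OF linear_coboundary weight_pos]
  let ?Y = "cells cdim k"
  \<comment> \<open>A crude common upper bound for all diagonal entries of H.\<close>
  define s where "s = (\<Sum>x\<in>UNIV. \<bar>hodge m \<delta> (cell x) $ x\<bar>)"
  have s: "hodge m \<delta> (cell x) $ x \<le> s" for x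
    unfolding s_def using member_le_sum[of x UNIV "\<lambda>x. \<bar>hodge m \<delta> (cell x) $ x\<bar>"] by simp
  \<comment> \<open>With the factor \<open>t\<close> included, -tH is \<open>K\<close> minus the
    scalar \<open>t * s\<close>, which splits off the exponential.\<close>
  define K where "K g = t *\<^sub>R (s *\<^sub>R g - hodge m \<delta> g)" for g
  have linK: "linear K"
    unfolding K_def by (intro linear_compose_scale_right linear_compose_sub linear_scaleR lin)
  have invK: "K g \<in> fun_space ?Y" if "g \<in> fun_space ?Y" for g
    using that hodge_in_fun_space[OF that] by (simp add: K_def fun_space_def)
  have row: "(\<Sum>y\<in>UNIV. \<omega> y * \<bar>K (cell y) $ x\<bar>) \<le> (t * (s - R)) * \<omega> x" if x: "x \<in> ?Y" for x
  proof -
    have "(\<Sum>y\<in>UNIV. \<omega> y * \<bar>K (cell y) $ x\<bar>) = (\<Sum>y\<in>?Y. \<omega> y * \<bar>K (cell y) $ x\<bar>)"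
    proof (intro sum.mono_neutral_right ballI)
      fix y assume "y \<in> UNIV - ?Y"
      then have "y \<noteq> x" "hodge m \<delta> (cell y) $ x = 0"
        using x cdim_eq_if_hodge_nonzero[of y x] by auto
      then show "\<omega> y * \<bar>K (cell y) $ x\<bar> = 0" by (simp add: K_def axis_nth_neq)
    qed auto
    \<comment> \<open>By the choice of \<open>s\<close> the diagonal entry of \<open>K\<close> is
      nonnegative. The diagonal entry of H then cancels against the one in the curvature bound,
      leaving \<open>t * (s - R)\<close>.\<close>
    also have "\<dots> = \<omega> x * \<bar>K (cell x) $ x\<bar> + (\<Sum>y\<in>?Y - {x}. \<omega> y * \<bar>K (cell y) $ x\<bar>)"
      using x by (intro sum.remove) auto
    also have "\<bar>K (cell x) $ x\<bar> = t * (s - hodge m \<delta> (cell x) $ x)"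
      using s[of x] t by (simp add: K_def abs_mult)
    also have "(\<Sum>y\<in>?Y - {x}. \<omega> y * \<bar>K (cell y) $ x\<bar>)
        = t * (\<Sum>y\<in>?Y - {x}. \<omega> y * \<bar>hodge m \<delta> (cell y) $ x\<bar>)"
      unfolding sum_distrib_left using t
      by (intro sum.cong) (auto simp: K_def axis_nth_neq abs_mult)
    also have "\<dots> \<le> t * ((hodge m \<delta> (cell x) $ x - R) * \<omega> x)"
      using F[OF x] forman_curv_ge_iff[where \<omega> = \<omega>, OF \<omega>, of x k R] x t by (intro mult_left_mono) auto
    finally show ?thesis by (simp add: algebra_simps)
  qed
  have "heat m \<delta> t f = op_exp (\<lambda>g. (- t * s) *\<^sub>R g + K g) f"
    unfolding heat_def K_def by (simp add: scaleR_diff_right)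
  also have "\<dots> = exp (- t * s) *\<^sub>R op_exp K f"
    by (rule op_exp_scaleR_add[OF linK])
  finally have heat: "heat m \<delta> t f = exp (- t * s) *\<^sub>R op_exp K f" .
  have "\<bar>heat m \<delta> t f $ x\<bar> \<le> exp (- R * t) * wnorm m \<omega> \<infinity> f * \<omega> x" for x
  proof (cases "x \<in> ?Y")
    case True
    have "\<bar>op_exp K f $ x\<bar> \<le> exp (t * (s - R)) * wnorm m \<omega> \<infinity> f * \<omega> x"
      using op_exp_bound[where \<omega> = \<omega>, OF linK invK \<omega> row f abs_le_wnorm_infinity[where \<omega> = \<omega>, OF \<omega>] True] .
    then have "\<bar>heat m \<delta> t f $ x\<bar> \<le> exp (- t * s) * (exp (t * (s - R)) * wnorm m \<omega> \<infinity> f * \<omega> x)"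
      by (simp add: heat abs_mult)
    \<comment> \<open>The auxiliary shift \<open>s\<close> cancels in the exponent.\<close>
    also have "\<dots> = exp (- t * s + t * (s - R)) * wnorm m \<omega> \<infinity> f * \<omega> x"
      by (simp only: exp_add mult.assoc)
    also have "- t * s + t * (s - R) = - R * t" by (simp add: algebra_simps)
    finally show ?thesis .
  next
    case False
    then have "heat m \<delta> t f $ x = 0"
      using op_exp_in_fun_space[OF linK invK f] by (simp add: heat fun_space_def)
    moreover have "0 \<le> wnorm m \<omega> \<infinity> f * \<omega> x"
      using abs_le_wnorm_infinity[where \<omega> = \<omega>, OF \<omega>, of f x m] by linarith
    ultimately show ?thesis by (simp add: mult.assoc)
  qed
  then show ?thesis by (simp only: wnorm_infinity_le_iff[where \<omega> = \<omega>, OF \<omega>] simp_thms)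
qed

text \<open>A supremum estimate for all functions is a bound on the absolute row sums of the heat
  kernel, which is what Schur's test needs. The time \<open>t\<close> is fixed throughout.\<close>

lemma heat_contraction_ereal:
  assumes \<omega>: "\<And>x. \<omega> x > 0"
    and contr: "\<And>f. f \<in> fun_space (cells cdim k) \<Longrightarrow>
      wnorm m \<omega> \<infinity> (heat m \<delta> t f) \<le> exp (- R * t) * wnorm m \<omega> \<infinity> f"
    and f: "f \<in> fun_space (cells cdim k)" and r: "r \<ge> 1"
  shows "wnorm m \<omega> (ereal r) (heat m \<delta> t f) \<le> exp (- R * t) * wnorm m \<omega> (ereal r) f"
proof -
  note lm = linear_coboundary weight_pos
  let ?Y = "cells cdim k"
  let ?T = "\<lambda>f. (- t) *\<^sub>R hodge m \<delta> f"
  have linT: "linear ?T"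
    by (intro linear_compose_scale_right linear_hodge lm)
  have invT: "?T g \<in> fun_space ?Y" if "g \<in> fun_space ?Y" for g
    using hodge_in_fun_space[OF that] by (simp add: fun_space_def)
  have symT: "scalar_prod m (?T f) g = scalar_prod m f (?T g)" for f g
    using hodge_symmetric[where m = m, OF lm, of f g] scalar_prod_commute scalar_prod_scaleR_left by metis
  have lin: "linear (heat m \<delta> t)"
    unfolding heat_def by (rule linear_op_exp[OF linT])
  show ?thesis
  proof (rule schur_test[where m = m and \<omega> = \<omega>, OF weight_pos \<omega> exp_gt_zero r lin _ _ _ f])
    show "scalar_prod m (heat m \<delta> t f) g = scalar_prod m f (heat m \<delta> t g)" for f g
      unfolding heat_def by (rule op_exp_symmetric[OF linT symT])
    show "heat m \<delta> t g \<in> fun_space ?Y" if "g \<in> fun_space ?Y" for g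
      unfolding heat_def by (rule op_exp_in_fun_space[OF linT invT that])
    fix x assume "x \<in> ?Y"
    \<comment> \<open>The signs of the row at \<open>x\<close>, scaled by \<open>\<omega>\<close>:
      the norm of \<open>g\<close> is at most 1, while the value of the heat operator on
      \<open>g\<close> at \<open>x\<close> is the weighted absolute row sum.\<close>
    define g :: "real ^ 'a"
      where "g = (\<chi> y. if y \<in> ?Y then \<omega> y * sgn (heat m \<delta> t (cell y) $ x) else 0)"
    have g: "g \<in> fun_space ?Y" by (simp add: g_def fun_space_def)
    have "wnorm m \<omega> \<infinity> g \<le> 1"
      unfolding wnorm_infinity_le_iff[where \<omega> = \<omega>, OF \<omega>]
      using less_imp_le[OF \<omega>] by (auto simp: g_def abs_mult abs_sgn_eq)
    have "heat m \<delta> t g $ x = (\<Sum>y\<in>?Y. \<omega> y * \<bar>heat m \<delta> t (cell y) $ x\<bar>)"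
      unfolding linear_nth_expansion[OF lin, of g x]
      by (intro sum.mono_neutral_cong_right) (auto simp: g_def mult.assoc abs_sgn mult.commute)
    then have "(\<Sum>y\<in>?Y. \<omega> y * \<bar>heat m \<delta> t (cell y) $ x\<bar>) \<le> exp (- R * t) * wnorm m \<omega> \<infinity> g * \<omega> x"
      using contr[OF g] unfolding wnorm_infinity_le_iff[where \<omega> = \<omega>, OF \<omega>] by (metis abs_le_D1)
    also have "\<dots> \<le> exp (- R * t) * 1 * \<omega> x"
      using \<open>wnorm m \<omega> \<infinity> g \<le> 1\<close> less_imp_le[OF \<omega>[of x]] by (intro mult_right_mono mult_left_mono) auto
    finally show "(\<Sum>y\<in>?Y. \<omega> y * \<bar>heat m \<delta> t (cell y) $ x\<bar>) \<le> exp (- R * t) * \<omega> x" by simp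
  qed
qed

text \<open>The test function attains the supremum defining the weighted row sum of \<open>H\<close> at \<open>x\<close>; both sides
  of the contraction estimate agree at \<open>t = 0\<close>, and their derivatives there are compared.\<close>

lemma forman_curv_ge_if_contraction:
  assumes \<omega>: "\<And>x. \<omega> x > 0"
    and contr: "\<And>f t. f \<in> fun_space (cells cdim k) \<Longrightarrow> t \<ge> 0 \<Longrightarrow>
      wnorm m \<omega> \<infinity> (heat m \<delta> t f) \<le> exp (- R * t) * wnorm m \<omega> \<infinity> f"
    and x: "cdim x = k"
  shows "forman_curv m \<delta> \<omega> x \<ge> R"
proof -
  note lin = linear_hodge[where m = m, OF linear_coboundary weight_pos]
  let ?Y = "cells cdim k"
  define f :: "real ^ 'a" where "f = (\<chi> y. if y = x then \<omega> x
    else if y \<in> ?Y then - \<omega> y * sgn (hodge m \<delta> (cell y) $ x) else 0)"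
  have f: "f \<in> fun_space ?Y" using x by (simp add: f_def fun_space_def)
  have f1: "wnorm m \<omega> \<infinity> f \<le> 1"
    unfolding wnorm_infinity_le_iff[where \<omega> = \<omega>, OF \<omega>]
    using less_imp_le[OF \<omega>] by (auto simp: f_def abs_mult abs_sgn_eq)
  \<comment> \<open>The slack in the contraction estimate at \<open>x\<close>. It is nonnegative for
    \<open>t \<ge> 0\<close> and zero at 0, so its derivative there cannot be negative.\<close>
  define h where "h t = exp (- R * t) * \<omega> x - heat m \<delta> t f $ x" for t
  have h_nonneg: "h t \<ge> 0" if "t \<ge> 0" for t
  proof -
    have "heat m \<delta> t f $ x \<le> exp (- R * t) * wnorm m \<omega> \<infinity> f * \<omega> x"
      using contr[OF f that] unfolding wnorm_infinity_le_iff[where \<omega> = \<omega>, OF \<omega>] by (metis abs_le_D1)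
    also have "\<dots> \<le> exp (- R * t) * 1 * \<omega> x"
      using f1 less_imp_le[OF \<omega>[of x]] by (intro mult_right_mono mult_left_mono) auto
    finally show ?thesis by (simp add: h_def)
  qed
  have "((\<lambda>t. op_exp (\<lambda>g. t *\<^sub>R (- hodge m \<delta> g)) f $ x) has_real_derivative (- hodge m \<delta> f) $ x) (at 0)"
    by (intro has_real_derivative_op_exp_0 linear_compose_neg lin)
  then have "((\<lambda>t. heat m \<delta> t f $ x) has_real_derivative - (hodge m \<delta> f $ x)) (at 0)"
    by (simp add: heat_def)
  then have h': "(h has_real_derivative hodge m \<delta> f $ x - R * \<omega> x) (at 0)"
    unfolding h_def by (auto intro!: derivative_eq_intros)
  \<comment> \<open>At time 0 the exponent is the zero map, so only the term of index 0 survives in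
    the series.\<close>
  have "heat m \<delta> 0 f = f"
  proof -
    show ?thesis
      unfolding heat_def op_exp_def
      by (subst suminf_finite[of "{0}"]) (auto dest: gr0_implies_Suc)
  qed
  then have "h 0 = 0" by (simp add: h_def f_def)
  have "hodge m \<delta> f $ x - R * \<omega> x \<ge> 0"
  proof (rule ccontr)
    assume "\<not> ?thesis"
    then obtain d where d: "d > 0" "\<And>e. 0 < e \<Longrightarrow> e < d \<Longrightarrow> h (0 + e) < h 0"
      using DERIV_neg_dec_right[OF h'] by force
    from d(2)[of "d / 2"] d(1) h_nonneg[of "d / 2"] \<open>h 0 = 0\<close> show False by simp
  qed
  \<comment> \<open>The signs in \<open>f\<close> turn every off-diagonal contribution into minus
    its absolute value, so the derivative of \<open>h\<close> is \<open>\<omega> x\<close> times the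
    curvature minus \<open>R\<close>.\<close>
  moreover have "hodge m \<delta> f $ x = \<omega> x * hodge m \<delta> (cell x) $ x
      - (\<Sum>y\<in>?Y - {x}. \<omega> y * \<bar>hodge m \<delta> (cell y) $ x\<bar>)"
  proof -
    have "hodge m \<delta> f $ x = f $ x * hodge m \<delta> (cell x) $ x + (\<Sum>y\<in>UNIV - {x}. f $ y * hodge m \<delta> (cell y) $ x)"
      unfolding linear_nth_expansion[OF lin, of f x] by (intro sum.remove) auto
    also have "(\<Sum>y\<in>UNIV - {x}. f $ y * hodge m \<delta> (cell y) $ x)
        = (\<Sum>y\<in>?Y - {x}. - (\<omega> y * \<bar>hodge m \<delta> (cell y) $ x\<bar>))"
      by (intro sum.mono_neutral_cong_right) (auto simp: f_def mult.assoc abs_sgn mult.commute)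
    finally show ?thesis by (simp add: f_def sum_negf)
  qed
  ultimately show ?thesis
    unfolding forman_curv_ge_iff[where \<omega> = \<omega>, OF \<omega> x] by (simp add: algebra_simps)
qed

end

theorem theorem7p1:
  fixes cdim :: "'a::finite \<Rightarrow> nat"
    and \<delta> :: "real ^ 'a \<Rightarrow> real ^ 'a"
    and m \<omega> :: "'a \<Rightarrow> real"
    and k :: nat
    and R :: real
  assumes "cell_complex cdim \<delta> m"
    and "\<And>x. \<omega> x > 0"
    and "non_degenerate cdim \<delta> \<omega>"
    and "k \<ge> 1"
  shows
    "((\<forall>x\<in>cells cdim k. forman_curv m \<delta> \<omega> x \<ge> R) \<longleftrightarrow>
      (\<forall>f\<in>fun_space (cells cdim k). \<forall>t\<ge>0.
         wnorm m \<omega> \<infinity> (heat m \<delta> t f) \<le> exp (- R * t) * wnorm m \<omega> \<infinity> f)) \<and>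
     ((\<forall>x\<in>cells cdim k. forman_curv m \<delta> \<omega> x \<ge> R) \<longleftrightarrow>
      (\<forall>f\<in>fun_space (cells cdim k). \<forall>p::ereal. 1 \<le> p \<longrightarrow> (\<forall>t\<ge>0.
         wnorm m \<omega> p (heat m \<delta> t f) \<le> exp (- R * t) * wnorm m \<omega> p f))) \<and>
     ((\<forall>x\<in>cells cdim k. forman_curv m \<delta> \<omega> x \<ge> R) \<longleftrightarrow>
      diag_dominant m \<omega> (cells cdim k) (\<lambda>f. hodge m \<delta> f - R *\<^sub>R f))"
    (is "(?i \<longleftrightarrow> ?ii) \<and> (?i \<longleftrightarrow> ?iii) \<and> (?i \<longleftrightarrow> ?iv)")
proof -
  interpret cell_complex cdim \<delta> m by fact
  note \<omega> = assms(2)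
  have "?i \<Longrightarrow> ?ii" using heat_contraction_infinity[where \<omega> = \<omega>, OF \<omega>] by blast
  moreover have "?ii \<Longrightarrow> ?i" using forman_curv_ge_if_contraction[where \<omega> = \<omega>, OF \<omega>] by blast
  \<comment> \<open>The case of infinite \<open>p\<close> is the supremum estimate itself, and
    finite \<open>p\<close> follow from it by Schur's test.\<close>
  moreover have ?iii if ii: ?ii
  proof (intro ballI allI impI)
    fix f :: "real ^ 'a" and p :: ereal and t :: real
    assume f: "f \<in> fun_space (cells cdim k)" and p: "1 \<le> p" and t: "0 \<le> t"
    show "wnorm m \<omega> p (heat m \<delta> t f) \<le> exp (- R * t) * wnorm m \<omega> p f"
    proof (cases p)
      case (real r)
      then show ?thesis using heat_contraction_ereal[where \<omega> = \<omega>, OF \<omega> _ f, of t R r] ii t p by simp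
    next
      case PInf
      then show ?thesis using ii f t by simp
    next
      case MInf
      then show ?thesis using p by simp
    qed
  qed
  \<comment> \<open>Specialization to infinite \<open>p\<close>.\<close>
  moreover have "?iii \<Longrightarrow> ?ii" by simp
  ultimately show ?thesis using forman_curv_ge_iff_diag_dominant[where \<omega> = \<omega>, OF \<omega>] by blast
qed

end
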